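(* Let $t_0>0$, $c>0$, $\alpha\ge 3$, and let $x:[t_0,+\infty[\to\mathcal H$ be a solution of $$\ddot x(t)+\frac{\alpha}{t}\dot x(t)+\nabla f(x(t))+\frac{c}{t^2}x(t)=0 .$$ Then the following hold. (i) If $\alpha=3$, then $f(x(t))-\min_{\mathcal H} f=O\left(\frac{\ln t}{t^2}\right)$ as $t\to+\infty$. (ii) If $\alpha>3$, then $f(x(t))-\min_{\mathcal H} f=O\left(\frac{1}{t^2}\right)$ as $t\to+\infty$. Further, the trajectory $x$ is bounded, $\|\dot x(t)\|=O\left(\frac1t\right)$ as $t\to+\infty$, and there is strong convergence to the minimum norm solution in the sense that $$\liminf_{t\to+\infty}\|x(t)-x^*\|=0 .$$
   Context: $\mathcal H$ is a real Hilbert space with scalar product $\langle\cdot,\cdot\rangle$ and norm $\|\cdot\|$. The function $f:\mathcal H\to\mathbb R$ is convex and (continuously) differentiable, and $\nabla f$ is Lipschitz continuous on bounded sets. The solution set $S=\operatorname{argmin} f$ is nonempty, and $x^*$ denotes the element of minimum norm of $S$, i.e. the projection of $0$ onto $S$. Solutions are classical (twice differentiable) solutions on $[t_0,+\infty[$. *)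

theory Defs
  imports "HOL-Analysis.Analysis" "HOL-Library.Landau_Symbols"
begin

definition argmin_set :: "('a \<Rightarrow> real) \<Rightarrow> 'a set" where
  "argmin_set f = {z. is_arg_min f (\<lambda>_. True) z}"

text \<open>In a Hilbert space the minimum-norm element of a nonempty closed convex set exists and
  is unique, so the description below is then well defined; it is the projection of 0.\<close>

definition min_norm_element :: "'a::real_normed_vector set \<Rightarrow> 'a" where
  "min_norm_element S = (THE z. z \<in> S \<and> (\<forall>y\<in>S. norm z \<le> norm y))"

definition lipschitz_on_bounded_sets ::
    "('a::metric_space \<Rightarrow> 'b::metric_space) \<Rightarrow> bool" where
  "lipschitz_on_bounded_sets g \<longleftrightarrow> (\<forall>B. bounded B \<longrightarrow> (\<exists>L. L-lipschitz_on B g))"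

text \<open>A classical solution \<open>x\<close> on \<open>[t0, \<infinity>)\<close> of the equation, with first and second
  derivatives \<open>x'\<close> and \<open>x''\<close> (one-sided at \<open>t0\<close>); \<open>g\<close> is the gradient field.\<close>

definition is_solution ::
    "('a::real_normed_vector \<Rightarrow> 'a) \<Rightarrow> real \<Rightarrow> real \<Rightarrow> real \<Rightarrow>
     (real \<Rightarrow> 'a) \<Rightarrow> (real \<Rightarrow> 'a) \<Rightarrow> (real \<Rightarrow> 'a) \<Rightarrow> bool" where
  "is_solution g \<alpha> c t0 x x' x'' \<longleftrightarrow>
     (\<forall>t\<ge>t0. (x has_vector_derivative x' t) (at t within {t0..})
           \<and> (x' has_vector_derivative x'' t) (at t within {t0..})
           \<and> x'' t + (\<alpha> / t) *\<^sub>R x' t + g (x t) + (c / t\<^sup>2) *\<^sub>R x t = 0)"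

end

theory Submission
  imports Defs
begin

text \<open>Let \<open>p\<close> be a minimizer of \<open>f\<close>. The whole proof rests on the family of energies
  \[ E_l(t) = t^2 (f(x) - f(p)) + \frac c2 \|x\|^2 + \frac12 \|l (x - p) + t x'\|^2
      + \frac{l(\alpha - 1 - l)}2 \|x - p\|^2 , \]
  all of whose terms are nonnegative for \<open>0 \<le> l \<le> \<alpha> - 1\<close>. The weight \<open>t\<^sup>2\<close> matches the
  Tikhonov coefficient \<open>c / t\<^sup>2\<close>: the regularizing term contributes the potential
  \<open>c / 2 * \<parallel>x\<parallel>\<^sup>2\<close>, whose weight does not depend on time. Along a solution the terms in
  \<open>x' \<bullet> gradf x\<close>, \<open>x' \<bullet> x\<close> and \<open>x' \<bullet> (x - p)\<close> all cancel, and convexity gives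
  (\<open>energy_deriv_le\<close>)
  \[ E_l' \le -(l - 2)\, t\, (f(x) - f(p)) - (\alpha - 1 - l)\, t\, \|x'\|^2
      + \frac{l c}{2 t} (\|p\|^2 - \|x\|^2 - \|x - p\|^2) . \]

  For \<open>\<alpha> = 3\<close> the choice \<open>l = 2\<close> leaves \<open>E' \<le> c \<parallel>p\<parallel>\<^sup>2 / t\<close>, so the energy grows at most
  logarithmically. For \<open>\<alpha> > 3\<close> one takes \<open>l\<close> strictly between \<open>2\<close> and \<open>\<alpha> - 1\<close>; every term of
  the energy is then damped, \<open>E' \<le> (K - k E) / t\<close> with \<open>k > 0\<close>, hence \<open>E\<close> is bounded
  (\<open>energy_bounded\<close>), and the rates and the boundedness of \<open>x\<close> are read off its terms.

  For the strong convergence let \<open>p\<close> be the minimizer of least norm. Since \<open>f (x t)\<close> tends to the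
  minimum, the lower limit of \<open>\<parallel>x t\<parallel>\<close> is at least \<open>\<parallel>p\<parallel>\<close> (\<open>norm_low_sublevel_ge\<close>). If \<open>x\<close>
  stayed at distance at least \<open>\<delta>\<close> from \<open>p\<close>, the last bracket above would eventually be below
  \<open>- \<delta>\<^sup>2 / 2\<close>; then \<open>E' \<le> - \<kappa> / t\<close> with \<open>\<kappa> > 0\<close>, and the nonnegative energy would tend to
  \<open>-\<infinity>\<close> like \<open>- \<kappa> ln t\<close> (\<open>frequently_near_min_norm\<close>).\<close>

section \<open>Intersections of convex sets and elements of least norm\<close>

text \<open>This replaces weak compactness of bounded sets. Almost norm-minimal points \<open>y n \<in> C n\<close> form
  a Cauchy sequence: for \<open>n \<le> m\<close> the midpoint of \<open>y n\<close> and \<open>y m\<close> lies in \<open>C n\<close>, and the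
  parallelogram law bounds \<open>\<parallel>y n - y m\<parallel>\<^sup>2\<close> by the gap between the squared distances \<open>d n\<close> and
  \<open>d m\<close> of these sets to the origin. Those distances increase and are bounded, so the gap
  vanishes.\<close>

lemma nested_closed_convex_Inter_nonempty:
  fixes C :: "nat \<Rightarrow> 'a::{real_inner, complete_space} set"
  assumes ne: "\<And>n. C n \<noteq> {}" and cl: "\<And>n. closed (C n)" and cv: "\<And>n. convex (C n)"
    and anti: "\<And>m n. m \<le> n \<Longrightarrow> C n \<subseteq> C m" and bd: "bounded (C 0)"
  shows "\<exists>q. \<forall>n. q \<in> C n"
proof -
  define d where "d n = (INF y\<in>C n. (norm y)\<^sup>2)" for n
  have bb: "bdd_below ((\<lambda>y. (norm y)\<^sup>2) ` C n)" for n
    by (rule bdd_belowI2[of _ 0]) simp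
  have dle: "d n \<le> (norm y)\<^sup>2" if "y \<in> C n" for n y
    unfolding d_def by (rule cINF_lower[OF bb that])
  have "\<exists>y\<in>C n. (norm y)\<^sup>2 < d n + inverse (Suc n)" for n
  proof -
    have "(INF y\<in>C n. (norm y)\<^sup>2) < d n + inverse (Suc n)"
      unfolding d_def by simp
    then show ?thesis
      using cINF_less_iff[OF ne bb] by blast
  qed
  then obtain y where y: "\<And>n. y n \<in> C n"
    and yd: "\<And>n. (norm (y n))\<^sup>2 < d n + inverse (Suc n)"
    by metis
  have "incseq d"
  proof (rule incseq_SucI)
    fix n show "d n \<le> d (Suc n)"
      unfolding d_def
      by (rule cINF_superset_mono[OF ne bb]) (use anti[of n "Suc n"] in auto)
  qed
  obtain R where R: "\<And>z. z \<in> C 0 \<Longrightarrow> norm z \<le> R"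
    using bd by (auto simp: bounded_iff)
  have "d n \<le> R\<^sup>2" for n
  proof -
    have "norm (y n) \<le> R" using y[of n] anti[of 0 n] R by blast
    then have "(norm (y n))\<^sup>2 \<le> R\<^sup>2" by (intro power_mono) auto
    then show ?thesis using dle[OF y[of n]] by linarith
  qed
  with \<open>incseq d\<close> obtain D where D: "d \<longlonglongrightarrow> D" "\<And>n. d n \<le> D"
    by (metis incseq_convergent)
  have close: "(norm (y n - y m))\<^sup>2 \<le> 2 * (D - d n) + 4 * inverse (Suc n)" if "n \<le> m" for n m
  proof -
    have "y m \<in> C n" using y[of m] anti[OF that] by blast
    then have "(1/2) *\<^sub>R y n + (1/2) *\<^sub>R y m \<in> C n"
      using convexD[OF cv[of n] y[of n]] by auto
    then have "d n \<le> (norm ((1/2) *\<^sub>R y n + (1/2) *\<^sub>R y m))\<^sup>2"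
      by (rule dle)
    then have mid: "4 * d n \<le> (norm (y n + y m))\<^sup>2"
      by (simp add: scaleR_add_right[symmetric] power_mult_distrib power2_eq_square)
    have "(norm (y n + y m))\<^sup>2 + (norm (y n - y m))\<^sup>2 = 2 * (norm (y n))\<^sup>2 + 2 * (norm (y m))\<^sup>2"
      by (simp add: power2_norm_eq_inner algebra_simps inner_commute)
    moreover have "inverse (real (Suc m)) \<le> inverse (real (Suc n))"
      using that by (simp add: field_simps)
    ultimately show ?thesis
      using mid yd[of n] yd[of m] D(2)[of m] by argo
  qed
  have lim0: "(\<lambda>n. 2 * (D - d n) + 4 * inverse (real (Suc n))) \<longlonglongrightarrow> 0"
    using tendsto_add[OF tendsto_mult_left[OF tendsto_diff[OF tendsto_const D(1)], of 2 D]
        tendsto_mult_left[OF LIMSEQ_inverse_real_of_nat, of 4]] by simp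
  have "Cauchy y"
  proof (unfold Cauchy_altdef2 dist_norm, intro allI impI)
    fix e :: real assume "0 < e"
    then have "\<forall>\<^sub>F n in sequentially. 2 * (D - d n) + 4 * inverse (real (Suc n)) < e\<^sup>2"
      using lim0 by (auto intro: order_tendstoD)
    then obtain N where N: "\<And>n. n \<ge> N \<Longrightarrow> 2 * (D - d n) + 4 * inverse (real (Suc n)) < e\<^sup>2"
      by (auto simp: eventually_sequentially)
    have "norm (y n - y N) < e" if "n \<ge> N" for n
    proof -
      have "(norm (y N - y n))\<^sup>2 < e\<^sup>2" using close[OF that] N[of N] by linarith
      then have "norm (y N - y n) < e" using \<open>0 < e\<close> by (auto elim: power2_less_imp_less)
      then show ?thesis by (simp add: norm_minus_commute)
    qed
    then show "\<exists>N. \<forall>n\<ge>N. norm (y n - y N) < e" by blast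
  qed
  then obtain q where q: "y \<longlonglongrightarrow> q" by (auto simp: Cauchy_convergent_iff convergent_def)
  have "q \<in> C n" for n
  proof -
    have "\<forall>\<^sub>F m in sequentially. y m \<in> C n"
      using eventually_ge_at_top[of n] by eventually_elim (use y anti in blast)
    then show ?thesis
      using Lim_in_closed_set[OF cl _ _ q] by simp
  qed
  then show ?thesis by blast
qed

text \<open>Existence comes from intersecting \<open>S\<close> with balls whose radii decrease to the infimum of the
  norm on \<open>S\<close>; uniqueness, which gives the definite description its meaning, from the
  parallelogram law.\<close>

lemma min_norm_element_works:
  fixes S :: "'a::{real_inner, complete_space} set"
  assumes ne: "S \<noteq> {}" and cl: "closed S" and cv: "convex S"
  shows "min_norm_element S \<in> S" and "\<And>y. y \<in> S \<Longrightarrow> norm (min_norm_element S) \<le> norm y"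
proof -
  define D where "D = (INF y\<in>S. norm y)"
  have bb: "bdd_below (norm ` S)" by (rule bdd_belowI2[of _ 0]) simp
  define C where "C n = S \<inter> cball 0 (D + inverse (real (Suc n)))" for n
  have "C n \<noteq> {}" for n
  proof -
    have "(INF y\<in>S. norm y) < D + inverse (real (Suc n))" unfolding D_def by simp
    then obtain y where "y \<in> S" "norm y < D + inverse (real (Suc n))"
      using cINF_less_iff[OF ne bb] by blast
    then have "y \<in> C n" by (simp add: C_def)
    then show ?thesis by blast
  qed
  moreover have "C n \<subseteq> C m" if "m \<le> n" for m n
  proof -
    have "inverse (real (Suc n)) \<le> inverse (real (Suc m))" using that by (simp add: field_simps)
    then show ?thesis
      unfolding C_def by (intro Int_mono subset_cball add_left_mono order_refl)
  qed
  moreover have "closed (C n)" "convex (C n)" for n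
    unfolding C_def using cl cv by (auto intro: closed_Int convex_Int)
  moreover have "bounded (C 0)"
    unfolding C_def by (rule bounded_Int) simp
  ultimately obtain q where q: "\<And>n. q \<in> C n"
    using nested_closed_convex_Inter_nonempty[of C] by blast
  have "(\<lambda>n. D + inverse (real (Suc n))) \<longlonglongrightarrow> D"
    using tendsto_add[OF tendsto_const LIMSEQ_inverse_real_of_nat, of D] by simp
  then have "norm q \<le> D"
    by (rule Lim_bounded2[where N=0]) (use q in \<open>auto simp: C_def\<close>)
  then have least: "norm q \<le> norm y" if "y \<in> S" for y
    using cINF_lower[OF bb that] by (simp add: D_def)
  have qS: "q \<in> S" using q by (simp add: C_def)
  have uniq: "z = q" if "z \<in> S" "\<forall>y\<in>S. norm z \<le> norm y" for z
  proof -
    have eq: "norm z = norm q" using that qS least by (simp add: order_antisym)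
    have "(1/2) *\<^sub>R z + (1/2) *\<^sub>R q \<in> S"
      using convexD[OF cv that(1) qS] by auto
    from least[OF this] have "2 * norm q \<le> norm (z + q)"
      by (simp add: scaleR_add_right[symmetric])
    then have "(2 * norm q)\<^sup>2 \<le> (norm (z + q))\<^sup>2" by (intro power_mono) auto
    moreover have "(norm (z + q))\<^sup>2 + (norm (z - q))\<^sup>2 = 2 * (norm z)\<^sup>2 + 2 * (norm q)\<^sup>2"
      by (simp add: power2_norm_eq_inner algebra_simps inner_commute)
    moreover have "(2 * norm q)\<^sup>2 = 2 * (norm z)\<^sup>2 + 2 * (norm q)\<^sup>2"
      using eq by (simp add: power_mult_distrib)
    ultimately have "(norm (z - q))\<^sup>2 \<le> 0" by linarith
    then show ?thesis by simp
  qed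
  have "min_norm_element S = q"
    unfolding min_norm_element_def using qS least uniq by (intro the_equality conjI ballI) blast+
  then show "min_norm_element S \<in> S" and "\<And>y. y \<in> S \<Longrightarrow> norm (min_norm_element S) \<le> norm y"
    using qS least by simp_all
qed

section \<open>Convex functions and their minimizers\<close>

lemma convex_on_sublevel:
  assumes "convex_on UNIV f"
  shows "convex {y. f y \<le> (a::real)}"
proof -
  have "f (u *\<^sub>R y + v *\<^sub>R z) \<le> a"
    if "f y \<le> a" "f z \<le> a" "0 \<le> u" "0 \<le> v" "u + v = 1" for y z u v
  proof -
    have "f (u *\<^sub>R y + v *\<^sub>R z) \<le> u * f y + v * f z"
      using assms that by (simp add: convex_on_def)
    also have "\<dots> \<le> a" using that by (simp add: convex_bound_le)
    finally show ?thesis .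
  qed
  then show ?thesis by (auto simp: convex_def)
qed

lemma closed_sublevel:
  fixes f :: "'a::real_normed_vector \<Rightarrow> real"
  assumes "continuous_on UNIV f"
  shows "closed {y. f y \<le> a}"
  using closed_Collect_le[OF assms continuous_on_const] .

text \<open>A form of weak lower semicontinuity of the norm: points of nearly minimal value cannot have
  a norm much smaller than that of the least-norm minimizer. Otherwise the sublevel sets
  at levels decreasing to the minimum would all meet the ball of radius \<open>r\<close>, and a common point
  of these intersections would be a minimizer of norm at most \<open>r\<close>.\<close>

lemma norm_low_sublevel_ge:
  fixes f :: "'a::{real_inner, complete_space} \<Rightarrow> real"
  assumes cv: "convex_on UNIV f" and co: "continuous_on UNIV f"
    and least: "\<And>q. (\<And>y. f q \<le> f y) \<Longrightarrow> norm p \<le> norm q"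
    and min: "\<And>y. f p \<le> f y" and r: "r < norm p"
  shows "\<exists>\<eta>>0. \<forall>y. f y \<le> f p + \<eta> \<longrightarrow> r \<le> norm y"
proof (rule ccontr)
  assume neg: "\<not> ?thesis"
  define C where "C n = {y. f y \<le> f p + inverse (real (Suc n))} \<inter> cball 0 r" for n
  have "C n \<noteq> {}" for n
  proof -
    have "0 < inverse (real (Suc n))" by simp
    then obtain y where "f y \<le> f p + inverse (real (Suc n))" "\<not> r \<le> norm y"
      using neg by blast
    then have "y \<in> C n" by (simp add: C_def)
    then show ?thesis by blast
  qed
  moreover have "C n \<subseteq> C m" if "m \<le> n" for m n
  proof -
    have "inverse (real (Suc n)) \<le> inverse (real (Suc m))" using that by (simp add: field_simps)
    note add_left_mono[OF this, of "f p"]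
    then show ?thesis
      unfolding C_def by (intro Int_mono Collect_mono impI order_refl) (erule order_trans)
  qed
  moreover have "closed (C n)" "convex (C n)" for n
    unfolding C_def using closed_sublevel[OF co] convex_on_sublevel[OF cv]
    by (auto intro: closed_Int convex_Int)
  moreover have "bounded (C 0)"
    unfolding C_def by (rule bounded_Int) simp
  ultimately obtain q where q: "\<And>n. q \<in> C n"
    using nested_closed_convex_Inter_nonempty[of C] by blast
  have "(\<lambda>n. f p + inverse (real (Suc n))) \<longlonglongrightarrow> f p"
    using tendsto_add[OF tendsto_const LIMSEQ_inverse_real_of_nat, of "f p"] by simp
  then have "f q \<le> f p"
    by (rule Lim_bounded2[where N=0]) (use q in \<open>auto simp: C_def\<close>)
  then have "norm p \<le> norm q"
    using least min order_trans by blast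
  moreover have "norm q \<le> r" using q[of 0] by (simp add: C_def)
  ultimately show False using r by linarith
qed

text \<open>Restricting \<open>f\<close> to the line through \<open>z\<close> and \<open>y\<close> reduces this to the tangent inequality on
  the real line.\<close>

lemma convex_on_above_tangent_GDERIV:
  fixes f :: "'a::real_inner \<Rightarrow> real"
  assumes cv: "convex_on UNIV f" and g: "GDERIV f z :> D"
  shows "f z + (y - z) \<bullet> D \<le> f y"
proof -
  define h where "h s = f (z + s *\<^sub>R (y - z))" for s :: real
  have "convex_on UNIV h"
  proof (rule convex_onI)
    fix t a b :: real assume "0 < t" "t < 1"
    have "z + ((1 - t) *\<^sub>R a + t *\<^sub>R b) *\<^sub>R (y - z)
        = (1 - t) *\<^sub>R (z + a *\<^sub>R (y - z)) + t *\<^sub>R (z + b *\<^sub>R (y - z))"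
      by (simp add: algebra_simps)
    then show "h ((1 - t) *\<^sub>R a + t *\<^sub>R b) \<le> (1 - t) * h a + t * h b"
      unfolding h_def using convex_onD[OF cv, of t] \<open>0 < t\<close> \<open>t < 1\<close> by simp
  qed auto
  moreover have "(h has_real_derivative (y - z) \<bullet> D) (at 0)"
  proof -
    have "((\<lambda>s. z + s *\<^sub>R (y - z)) has_derivative (\<lambda>s. s *\<^sub>R (y - z))) (at 0)"
      by (auto intro!: derivative_eq_intros)
    moreover have "(f has_derivative (\<lambda>h. h \<bullet> D)) (at (z + 0 *\<^sub>R (y - z)))"
      using g by (simp add: gderiv_def)
    ultimately have "((\<lambda>s. f (z + s *\<^sub>R (y - z))) has_derivative (\<lambda>s. (s *\<^sub>R (y - z)) \<bullet> D)) (at 0)"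
      by (rule has_derivative_compose)
    then show ?thesis
      unfolding h_def has_field_derivative_def
      by (rule has_derivative_eq_rhs) (simp add: fun_eq_iff mult.commute)
  qed
  ultimately have "h 1 - h 0 \<ge> (y - z) \<bullet> D * (1 - 0)"
    by (intro convex_on_imp_above_tangent[where A=UNIV]) auto
  then show ?thesis by (simp add: h_def)
qed

lemma continuous_on_GDERIV:
  assumes "\<And>z. GDERIV f z :> g z"
  shows "continuous_on A f"
  by (intro continuous_at_imp_continuous_on ballI has_derivative_continuous)
     (rule assms[unfolded gderiv_def])

text \<open>The derivative at the left end point \<open>a\<close> is one-sided, as it is for a solution at its
  initial time; the sign is required only from \<open>s\<close> on.\<close>

lemma nonincreasing_if_derivative_nonpos:
  fixes F F' :: "real \<Rightarrow> real"
  assumes der: "\<And>t. t \<ge> a \<Longrightarrow> (F has_real_derivative F' t) (at t within {a..})"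
    and neg: "\<And>t. s \<le> t \<Longrightarrow> F' t \<le> 0" and "a \<le> s" "s \<le> t"
  shows "F t \<le> F s"
proof (rule DERIV_nonpos_imp_decreasing_open[OF \<open>s \<le> t\<close>])
  fix u assume u: "s < u" "u < t"
  then have "at u within {a..} = at u"
    using \<open>a \<le> s\<close> by (intro at_within_interior) auto
  then show "\<exists>y. (F has_real_derivative y) (at u) \<and> y \<le> 0"
    using der[of u] neg[of u] u \<open>a \<le> s\<close> by auto
next
  have "continuous_on {a..} F"
    by (rule DERIV_continuous_on) (use der in auto)
  then show "continuous_on {s..t} F"
    by (rule continuous_on_subset) (use \<open>a \<le> s\<close> in auto)
qed

lemma norm_square_has_derivative:
  fixes u :: "real \<Rightarrow> 'a::real_inner"
  assumes "(u has_vector_derivative u') (at t within A)"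
  shows "((\<lambda>s. (norm (u s))\<^sup>2) has_real_derivative 2 * (u t \<bullet> u')) (at t within A)"
proof -
  note d = assms[unfolded has_vector_derivative_def]
  have "(\<lambda>h. u t \<bullet> (h *\<^sub>R u') + (h *\<^sub>R u') \<bullet> u t) = (*) (2 * (u t \<bullet> u'))"
    by (rule ext) (simp add: inner_commute[of u'])
  then show ?thesis
    using has_derivative_inner[OF d d]
    by (simp only: power2_norm_eq_inner has_field_derivative_def)
qed

section \<open>The energy of a trajectory\<close>

text \<open>The point \<open>p\<close> is an arbitrary minimizer; that it has least norm is added only where the
  distance to it is estimated.\<close>

locale tikhonov_trajectory =
  fixes f :: "'a::{real_inner, complete_space} \<Rightarrow> real" and gradf :: "'a \<Rightarrow> 'a"
    and \<alpha> c t0 :: real and x x' x'' :: "real \<Rightarrow> 'a" and p :: 'a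
  assumes cv: "convex_on UNIV f"
    and grad: "\<And>z. GDERIV f z :> gradf z"
    and min: "\<And>y. f p \<le> f y"
    and t0: "t0 > 0" and c: "c > 0"
    and sol: "is_solution gradf \<alpha> c t0 x x' x''"
begin

definition energy :: "real \<Rightarrow> real \<Rightarrow> real" where
  "energy l t = t\<^sup>2 * (f (x t) - f p) + c / 2 * (norm (x t))\<^sup>2
     + (norm (l *\<^sub>R (x t - p) + t *\<^sub>R x' t))\<^sup>2 / 2
     + l * (\<alpha> - 1 - l) / 2 * (norm (x t - p))\<^sup>2"

text \<open>The derivative of the energy after the equation has been used to eliminate the second
  derivative of \<open>x\<close>.\<close>

definition energy_deriv :: "real \<Rightarrow> real \<Rightarrow> real" where
  "energy_deriv l t = 2 * t * (f (x t) - f p) - l * t * ((x t - p) \<bullet> gradf (x t))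
     - l * (c / t) * ((x t - p) \<bullet> x t) - (\<alpha> - 1 - l) * t * (norm (x' t))\<^sup>2"

text \<open>The equation, multiplied by \<open>t\<close>, turns the derivative of \<open>l (x - p) + t x'\<close> into
  \<open>(l + 1 - \<alpha>) x' - t gradf x - (c / t) x\<close>. Its products with \<open>t x'\<close> cancel the derivatives of
  \<open>f (x t)\<close> and of \<open>c / 2 * \<parallel>x\<parallel>\<^sup>2\<close>, and the coefficient of \<open>\<parallel>x - p\<parallel>\<^sup>2\<close> in the energy is the one
  that cancels \<open>(x - p) \<bullet> x'\<close>.\<close>

lemma energy_has_derivative:
  assumes "t \<ge> t0"
  shows "(energy l has_real_derivative energy_deriv l t) (at t within {t0..})"
proof -
  have t: "t > 0" using assms t0 by linarith
  have dx: "(x has_vector_derivative x' t) (at t within {t0..})"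
    and dx': "(x' has_vector_derivative x'' t) (at t within {t0..})"
    and ode: "x'' t + (\<alpha> / t) *\<^sub>R x' t + gradf (x t) + (c / t\<^sup>2) *\<^sub>R x t = 0"
    using sol assms unfolding is_solution_def by auto
  have dfx: "((\<lambda>s. f (x s)) has_real_derivative x' t \<bullet> gradf (x t)) (at t within {t0..})"
    using has_derivative_compose[OF dx[unfolded has_vector_derivative_def]
        grad[of "x t", unfolded gderiv_def]]
    unfolding has_field_derivative_def
    by (rule has_derivative_eq_rhs) (simp add: fun_eq_iff mult.commute)
  have "x'' t = - ((\<alpha> / t) *\<^sub>R x' t + gradf (x t) + (c / t\<^sup>2) *\<^sub>R x t)"
    using ode by (simp add: eq_neg_iff_add_eq_0 algebra_simps)
  moreover have "t * (\<alpha> / t) = \<alpha>" "t * (c / t\<^sup>2) = c / t"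
    using t by (simp_all add: power2_eq_square)
  ultimately have tx'': "t *\<^sub>R x'' t = - (\<alpha> *\<^sub>R x' t + t *\<^sub>R gradf (x t) + (c / t) *\<^sub>R x t)"
    by (simp only: scaleR_minus_right scaleR_add_right scaleR_scaleR)
  define v where "v = l *\<^sub>R (x t - p) + t *\<^sub>R x' t"
  have dxp: "((\<lambda>s. x s - p) has_vector_derivative x' t) (at t within {t0..})"
    using has_vector_derivative_diff[OF dx has_vector_derivative_const[of p]] by simp
  have dv: "((\<lambda>s. l *\<^sub>R (x s - p) + s *\<^sub>R x' s) has_vector_derivative
      l *\<^sub>R x' t + (t *\<^sub>R x'' t + x' t)) (at t within {t0..})"
    using has_vector_derivative_add[OF
        has_vector_derivative_scaleR[OF DERIV_const[of l] dxp]
        has_vector_derivative_scaleR[OF DERIV_ident dx']] by simp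
  have sq: "((\<lambda>s. s\<^sup>2 * (f (x s) - f p)) has_real_derivative
      2 * t * (f (x t) - f p) + t\<^sup>2 * (x' t \<bullet> gradf (x t))) (at t within {t0..})"
    by (rule derivative_eq_intros dfx refl)+ simp
  have "(energy l has_real_derivative
      2 * t * (f (x t) - f p) + t\<^sup>2 * (x' t \<bullet> gradf (x t))
      + c / 2 * (2 * (x t \<bullet> x' t)) + 2 * (v \<bullet> (l *\<^sub>R x' t + (t *\<^sub>R x'' t + x' t))) / 2
      + l * (\<alpha> - 1 - l) / 2 * (2 * ((x t - p) \<bullet> x' t))) (at t within {t0..})"
    unfolding energy_def[abs_def] v_def
    by (intro DERIV_add sq DERIV_cmult DERIV_cdivide norm_square_has_derivative dx dxp dv)
  moreover have "2 * t * (f (x t) - f p) + t\<^sup>2 * (x' t \<bullet> gradf (x t))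
      + c / 2 * (2 * (x t \<bullet> x' t)) + 2 * (v \<bullet> (l *\<^sub>R x' t + (t *\<^sub>R x'' t + x' t))) / 2
      + l * (\<alpha> - 1 - l) / 2 * (2 * ((x t - p) \<bullet> x' t)) = energy_deriv l t"
  proof -
    define y g z where "y = x t - p" and "g = gradf (x t)" and "z = x t"
    have "t\<^sup>2 * (x' t \<bullet> g) + c * (z \<bullet> x' t)
        + (l *\<^sub>R y + t *\<^sub>R x' t) \<bullet> (l *\<^sub>R x' t + (- (\<alpha> *\<^sub>R x' t + t *\<^sub>R g + (c / t) *\<^sub>R z) + x' t))
        + l * (\<alpha> - 1 - l) * (y \<bullet> x' t)
      = - (l * t * (y \<bullet> g)) - l * (c / t) * (y \<bullet> z) - (\<alpha> - 1 - l) * t * (x' t \<bullet> x' t)"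
      using t by (simp add: inner_add_left inner_add_right inner_diff_right inner_commute
          algebra_simps power2_eq_square)
    then show ?thesis
      unfolding tx'' v_def energy_deriv_def power2_norm_eq_inner y_def g_def z_def
      by simp
  qed
  ultimately show ?thesis by simp
qed

text \<open>Besides the tangent inequality at \<open>x t\<close>, only the identity
  \<open>2 (x - p) \<bullet> x = \<parallel>x - p\<parallel>\<^sup>2 + \<parallel>x\<parallel>\<^sup>2 - \<parallel>p\<parallel>\<^sup>2\<close> enters. Being an identity, it keeps the term
  \<open>\<parallel>x - p\<parallel>\<^sup>2\<close> on which the strong convergence depends.\<close>

lemma energy_deriv_le:
  assumes "t \<ge> t0" "l \<ge> 0"
  shows "energy_deriv l t \<le> (2 - l) * (t * (f (x t) - f p))
     + l * c / 2 * (((norm p)\<^sup>2 - (norm (x t))\<^sup>2 - (norm (x t - p))\<^sup>2) / t)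
     - (\<alpha> - 1 - l) * (t * (norm (x' t))\<^sup>2)"
proof -
  have t: "t > 0" using assms t0 by linarith
  have cross: "(x t - p) \<bullet> x t = ((norm (x t - p))\<^sup>2 + (norm (x t))\<^sup>2 - (norm p)\<^sup>2) / 2"
    by (simp add: power2_norm_eq_inner inner_diff_left inner_diff_right inner_commute)
  have "f (x t) + (p - x t) \<bullet> gradf (x t) \<le> f p"
    by (rule convex_on_above_tangent_GDERIV[OF cv grad])
  then have "f (x t) - f p \<le> (x t - p) \<bullet> gradf (x t)"
    by (simp add: inner_diff_left)
  then have "l * t * (f (x t) - f p) \<le> l * t * ((x t - p) \<bullet> gradf (x t))"
    using t assms by (intro mult_left_mono) auto
  moreover have "l * (c / t) * ((x t - p) \<bullet> x t)
      = - (l * c / 2 * (((norm p)\<^sup>2 - (norm (x t))\<^sup>2 - (norm (x t - p))\<^sup>2) / t))"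
    unfolding cross using t by (simp add: field_simps)
  ultimately show ?thesis
    unfolding energy_deriv_def by (simp add: algebra_simps)
qed

lemma energy_dominates:
  assumes "0 \<le> l" "l \<le> \<alpha> - 1"
  shows "t\<^sup>2 * (f (x t) - f p) \<le> energy l t" and "c / 2 * (norm (x t))\<^sup>2 \<le> energy l t"
    and "(norm (l *\<^sub>R (x t - p) + t *\<^sub>R x' t))\<^sup>2 / 2 \<le> energy l t" and "0 \<le> energy l t"
proof -
  have "0 \<le> t\<^sup>2 * (f (x t) - f p)" using min[of "x t"] by simp
  moreover have "0 \<le> c / 2 * (norm (x t))\<^sup>2" using c by simp
  moreover have "0 \<le> l * (\<alpha> - 1 - l) / 2 * (norm (x t - p))\<^sup>2" using assms by simp
  ultimately show "t\<^sup>2 * (f (x t) - f p) \<le> energy l t" and "c / 2 * (norm (x t))\<^sup>2 \<le> energy l t"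
    and "(norm (l *\<^sub>R (x t - p) + t *\<^sub>R x' t))\<^sup>2 / 2 \<le> energy l t" and "0 \<le> energy l t"
    unfolding energy_def
    using zero_le_power2[of "norm (l *\<^sub>R (x t - p) + t *\<^sub>R x' t)"] by linarith+
qed

text \<open>For \<open>\<alpha> = 3\<close> and \<open>l = 2\<close> both damping coefficients \<open>l - 2\<close> and \<open>\<alpha> - 1 - l\<close> vanish, so the
  only usable estimate is \<open>E' \<le> c \<parallel>p\<parallel>\<^sup>2 / t\<close>; this is the origin of the logarithm.\<close>

lemma values_critical_bound:
  assumes "\<alpha> = 3" "t \<ge> t0"
  shows "t\<^sup>2 * (f (x t) - f p) \<le> energy 2 t0 + c * (norm p)\<^sup>2 * (ln t - ln t0)"
proof -
  define F where "F s = energy 2 s - c * (norm p)\<^sup>2 * ln s" for s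
  have "F t \<le> F t0"
  proof (rule nonincreasing_if_derivative_nonpos[where a=t0 and F=F and 
      F'="\<lambda>s. energy_deriv 2 s - c * (norm p)\<^sup>2 * (1 / s)"])
    fix s assume s: "t0 \<le> s"
    then have s0: "s > 0" using t0 by linarith
    show "(F has_real_derivative energy_deriv 2 s - c * (norm p)\<^sup>2 * (1 / s)) (at s within {t0..})"
      unfolding F_def using s0
      by (auto intro!: derivative_eq_intros energy_has_derivative[OF s])
    have "energy_deriv 2 s \<le> c * (((norm p)\<^sup>2 - (norm (x s))\<^sup>2 - (norm (x s - p))\<^sup>2) / s)"
      using energy_deriv_le[OF s, of 2] \<open>\<alpha> = 3\<close> by simp
    also have "\<dots> \<le> c * ((norm p)\<^sup>2 / s)"
      using c s0 by (intro mult_left_mono divide_right_mono) auto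
    finally show "energy_deriv 2 s - c * (norm p)\<^sup>2 * (1 / s) \<le> 0" by simp
  qed (use assms in auto)
  then show ?thesis
    using energy_dominates(1)[of 2 t] \<open>\<alpha> = 3\<close> by (simp add: F_def algebra_simps)
qed

text \<open>The parameter \<open>l = (\<alpha> + 1) / 2\<close> is the midpoint of \<open>2\<close> and \<open>\<alpha> - 1\<close>, where the damping
  coefficients of the values and of the velocity coincide: both equal \<open>\<mu> = (\<alpha> - 3) / 2\<close>. The
  energy is controlled by the damped quantities because \<open>\<parallel>l (x - p) + t x'\<parallel>\<^sup>2\<close> is at most
  \<open>2 (l\<^sup>2 \<parallel>x - p\<parallel>\<^sup>2 + t\<^sup>2 \<parallel>x'\<parallel>\<^sup>2)\<close>, while the Tikhonov term damps \<open>\<parallel>x\<parallel>\<^sup>2\<close> and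
  \<open>\<parallel>x - p\<parallel>\<^sup>2\<close>.\<close>

lemma energy_dissipation:
  assumes "\<alpha> > 3"
  shows "\<exists>k>0. \<forall>t\<ge>t0. energy_deriv ((\<alpha> + 1) / 2) t
           \<le> ((\<alpha> + 1) * c * (norm p)\<^sup>2 / 4 - k * energy ((\<alpha> + 1) / 2) t) / t"
proof -
  define l where "l = (\<alpha> + 1) / 2"
  define \<mu> where "\<mu> = (\<alpha> - 3) / 2"
  have \<mu>: "\<mu> > 0" "2 - l = - \<mu>" "\<alpha> - 1 - l = \<mu>" "l = \<mu> + 2"
    using assms by (auto simp: l_def \<mu>_def field_simps)
  define M where "M = l + \<alpha> - 1"
  \<comment> \<open>Collecting the two multiples of \<open>\<parallel>x - p\<parallel>\<^sup>2\<close> in the upper bound for the energy gives the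
    coefficient \<open>l * M / 2\<close>, since \<open>l\<^sup>2 + l (\<alpha> - 1 - l) / 2 = l (l + \<alpha> - 1) / 2\<close>.\<close>
  have "M > 0" using assms by (simp add: M_def l_def field_simps)
  define k where "k = Min {\<mu>, c / M}"
  have k: "k > 0" "k \<le> \<mu>" "k * M \<le> c"
    using \<mu> c \<open>M > 0\<close> by (auto simp: k_def min_def field_simps)
  have "energy_deriv l t \<le> (l * c / 2 * (norm p)\<^sup>2 - k * energy l t) / t" if "t \<ge> t0" for t
  proof -
    have t: "t > 0" using that t0 by linarith
    define a b e w where "a = t\<^sup>2 * (f (x t) - f p)" and "b = (norm (x t))\<^sup>2"
      and "e = (norm (x t - p))\<^sup>2" and "w = t\<^sup>2 * (norm (x' t))\<^sup>2"
    have nn: "a \<ge> 0" "b \<ge> 0" "e \<ge> 0" "w \<ge> 0"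
      using min[of "x t"] by (auto simp: a_def b_def e_def w_def)
    have "(norm (l *\<^sub>R (x t - p) + t *\<^sub>R x' t))\<^sup>2 + (norm (l *\<^sub>R (x t - p) - t *\<^sub>R x' t))\<^sup>2
        = 2 * (l\<^sup>2 * e) + 2 * w"
      unfolding e_def w_def power2_norm_eq_inner
      by (simp add: algebra_simps inner_commute power2_eq_square)
    then have "(norm (l *\<^sub>R (x t - p) + t *\<^sub>R x' t))\<^sup>2 / 2 \<le> l\<^sup>2 * e + w"
      using zero_le_power2[of "norm (l *\<^sub>R (x t - p) - t *\<^sub>R x' t)"] by linarith
    then have "energy l t \<le> a + c / 2 * b + (l\<^sup>2 * e + w) + l * (\<alpha> - 1 - l) / 2 * e"
      unfolding energy_def a_def b_def e_def w_def by linarith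
    also have "\<dots> = a + c / 2 * b + w + l * M / 2 * e"
      by (simp add: M_def power2_eq_square algebra_simps add_divide_distrib diff_divide_distrib)
    finally have "k * energy l t \<le> k * (a + c / 2 * b + w + l * M / 2 * e)"
      using k by (intro mult_left_mono) auto
    also have "\<dots> = k * a + k * (c / 2 * b) + k * w + l / 2 * ((k * M) * e)"
      by (simp add: algebra_simps)
    also have "\<dots> \<le> \<mu> * a + l * (c / 2 * b) + \<mu> * w + l / 2 * (c * e)"
      using k \<mu> nn c by (intro add_mono mult_right_mono mult_left_mono) auto
    finally have kE: "k * energy l t \<le> \<mu> * a + l * (c / 2 * b) + \<mu> * w + l / 2 * (c * e)" .
    have "energy_deriv l t \<le> (2 - l) * (t * (f (x t) - f p))
       + l * c / 2 * (((norm p)\<^sup>2 - (norm (x t))\<^sup>2 - (norm (x t - p))\<^sup>2) / t)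
       - (\<alpha> - 1 - l) * (t * (norm (x' t))\<^sup>2)"
      using \<mu> by (intro energy_deriv_le[OF that]) auto
    also have "\<dots> = (l * c / 2 * (norm p)\<^sup>2
        - (\<mu> * a + l * (c / 2 * b) + \<mu> * w + l / 2 * (c * e))) / t"
      unfolding a_def b_def e_def w_def \<mu>(2,3)
      using t by (simp add: field_simps power2_eq_square)
    also have "\<dots> \<le> (l * c / 2 * (norm p)\<^sup>2 - k * energy l t) / t"
      using t kE by (intro divide_right_mono) auto
    finally show ?thesis .
  qed
  then show ?thesis using k(1) unfolding l_def
    by (intro exI[of _ k]) (auto simp: field_simps)
qed

text \<open>The inequality \<open>E' \<le> (K - k E) / t\<close> says that \<open>t powr k * (E - K / k)\<close> is
  nonincreasing.\<close>

lemma energy_bounded: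
  assumes "\<alpha> > 3"
  shows "\<exists>B. \<forall>t\<ge>t0. energy ((\<alpha> + 1) / 2) t \<le> B"
proof -
  define l where "l = (\<alpha> + 1) / 2"
  define K where "K = (\<alpha> + 1) * c * (norm p)\<^sup>2 / 4"
  obtain k where k: "k > 0"
    and dis: "\<And>t. t \<ge> t0 \<Longrightarrow> energy_deriv l t \<le> (K - k * energy l t) / t"
    using energy_dissipation[OF assms] unfolding l_def K_def by blast
  define F where "F s = s powr k * (energy l s - K / k)" for s
  have mono: "F t \<le> F t0" if "t \<ge> t0" for t
  proof (rule nonincreasing_if_derivative_nonpos[where a=t0 and F=F and 
      F'="\<lambda>s. s powr k * energy_deriv l s + k * s powr (k - 1) * (energy l s - K / k)"])
    fix s assume s: "t0 \<le> s"
    then have s0: "s > 0" using t0 by linarith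
    show "(F has_real_derivative
        s powr k * energy_deriv l s + k * s powr (k - 1) * (energy l s - K / k)) (at s within {t0..})"
      unfolding F_def using s0
      by (auto intro!: derivative_eq_intros energy_has_derivative[OF s])
    have "s powr k * energy_deriv l s \<le> s powr k * ((K - k * energy l s) / s)"
      by (intro mult_left_mono dis[OF s]) auto
    also have "\<dots> = - (k * s powr (k - 1) * (energy l s - K / k))"
      using s0 k by (simp add: powr_diff field_simps)
    finally show "s powr k * energy_deriv l s + k * s powr (k - 1) * (energy l s - K / k) \<le> 0"
      by simp
  qed (use that in auto)
  have "energy l t \<le> \<bar>F t0\<bar> / t0 powr k + K / k" if "t \<ge> t0" for t
  proof -
    have "energy l t - K / k = F t / t powr k" using that t0 by (simp add: F_def)
    also have "\<dots> \<le> \<bar>F t0\<bar> / t powr k"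
      using mono[OF that] by (intro divide_right_mono) auto
    also have "\<dots> \<le> \<bar>F t0\<bar> / t0 powr k"
      using that t0 k by (intro divide_left_mono powr_mono2 mult_pos_pos) auto
    finally show ?thesis by simp
  qed
  then show ?thesis unfolding l_def by blast
qed

lemma supercritical_bounds:
  assumes "\<alpha> > 3"
  obtains B R V where "\<And>t. t \<ge> t0 \<Longrightarrow> t\<^sup>2 * (f (x t) - f p) \<le> B"
    and "\<And>t. t \<ge> t0 \<Longrightarrow> norm (x t) \<le> R"
    and "\<And>t. t \<ge> t0 \<Longrightarrow> t * norm (x' t) \<le> V"
proof -
  define l where "l = (\<alpha> + 1) / 2"
  have l: "0 \<le> l" "l \<le> \<alpha> - 1" using assms by (auto simp: l_def)
  obtain B where B: "\<And>t. t \<ge> t0 \<Longrightarrow> energy l t \<le> B"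
    using energy_bounded[OF assms] unfolding l_def by blast
  define R where "R = sqrt (2 * B / c)"
  have xR: "norm (x t) \<le> R" if "t \<ge> t0" for t
  proof -
    have "c / 2 * (norm (x t))\<^sup>2 \<le> B"
      using energy_dominates(2)[OF l] B[OF that] by (rule order_trans)
    then have "(norm (x t))\<^sup>2 \<le> 2 * B / c" using c by (simp add: field_simps)
    then show ?thesis unfolding R_def by (rule real_le_rsqrt)
  qed
  have "t * norm (x' t) \<le> sqrt (2 * B) + l * (R + norm p)" if "t \<ge> t0" for t
  proof -
    have t: "t > 0" using that t0 by linarith
    have "(norm (l *\<^sub>R (x t - p) + t *\<^sub>R x' t))\<^sup>2 / 2 \<le> B"
      using energy_dominates(3)[OF l] B[OF that] by (rule order_trans)
    then have 1: "norm (l *\<^sub>R (x t - p) + t *\<^sub>R x' t) \<le> sqrt (2 * B)"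
      by (intro real_le_rsqrt) simp
    have "norm (x t - p) \<le> R + norm p"
      using norm_triangle_ineq4[of "x t" p] xR[OF that] by linarith
    then have "norm (l *\<^sub>R (x t - p)) \<le> l * (R + norm p)"
      using l by (simp add: mult_left_mono)
    then have "norm (t *\<^sub>R x' t) \<le> sqrt (2 * B) + l * (R + norm p)"
      using 1 norm_triangle_ineq4[of "l *\<^sub>R (x t - p) + t *\<^sub>R x' t" "l *\<^sub>R (x t - p)"]
      by simp
    then show ?thesis using t by simp
  qed
  moreover have "t\<^sup>2 * (f (x t) - f p) \<le> B" if "t \<ge> t0" for t
    using energy_dominates(1)[OF l] B[OF that] by (rule order_trans)
  ultimately show thesis using that xR by blast
qed

lemma values_tendsto_min:
  assumes "\<alpha> > 3"
  shows "((\<lambda>t. f (x t)) \<longlongrightarrow> f p) at_top"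
proof -
  obtain B where B: "\<And>t. t \<ge> t0 \<Longrightarrow> t\<^sup>2 * (f (x t) - f p) \<le> B"
    using supercritical_bounds[OF assms] by metis
  have "((\<lambda>t::real. B / t\<^sup>2) \<longlongrightarrow> 0) at_top"
    by (intro tendsto_divide_0[OF tendsto_const] filterlim_at_top_imp_at_infinity
        filterlim_pow_at_top filterlim_ident) auto
  then have upper: "((\<lambda>t::real. f p + B / t\<^sup>2) \<longlongrightarrow> f p) at_top"
    using tendsto_add[OF tendsto_const, of _ 0 at_top "f p"] by simp
  have le: "\<forall>\<^sub>F t in at_top. f (x t) \<le> f p + B / t\<^sup>2"
    using eventually_ge_at_top[of t0]
  proof eventually_elim
    case (elim t)
    then show ?case using B[of t] t0 by (simp add: field_simps)
  qed
  have ge: "\<forall>\<^sub>F t in at_top. f p \<le> f (x t)"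
    using min by (intro always_eventually allI)
  show ?thesis
    by (rule tendsto_sandwich[OF ge le tendsto_const upper])
qed

text \<open>If \<open>x\<close> stayed away from \<open>p\<close>, then \<open>energy l t + \<kappa> ln t\<close> would be nonincreasing from some
  time on, which is impossible for a nonnegative energy.\<close>

lemma frequently_near_min_norm:
  assumes "\<alpha> > 3" "\<delta> > 0"
    and least: "\<And>q. (\<And>y. f q \<le> f y) \<Longrightarrow> norm p \<le> norm q"
  shows "\<exists>\<^sub>F t in at_top. norm (x t - p) < \<delta>"
proof (rule ccontr)
  assume "\<not> ?thesis"
  then have far: "\<forall>\<^sub>F t in at_top. \<delta> \<le> norm (x t - p)"
    by (simp add: frequently_def not_less)
  define l where "l = (\<alpha> + 1) / 2"
  have l: "0 < l" "l \<le> \<alpha> - 1" "2 \<le> l" using assms by (auto simp: l_def)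
  have co: "continuous_on UNIV f"
    by (rule continuous_on_GDERIV[OF grad])
  have low: "\<forall>\<^sub>F t in at_top. (norm p)\<^sup>2 - \<delta>\<^sup>2 / 2 \<le> (norm (x t))\<^sup>2"
    \<comment> \<open>The radius \<open>r\<close> below is a square root, so a nonpositive radicand is treated apart.\<close>
  proof (cases "(norm p)\<^sup>2 \<le> \<delta>\<^sup>2 / 2")
    case True
    then have "(norm p)\<^sup>2 - \<delta>\<^sup>2 / 2 \<le> (norm (x t))\<^sup>2" for t
      using zero_le_power2[of "norm (x t)"] by linarith
    then show ?thesis by simp
  next
    case False
    define r where "r = sqrt ((norm p)\<^sup>2 - \<delta>\<^sup>2 / 2)"
    have "r < sqrt ((norm p)\<^sup>2)"
      unfolding r_def using \<open>\<delta> > 0\<close> by (intro real_sqrt_less_mono) simp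
    then have "r < norm p" by simp
    then obtain \<eta> where \<eta>: "\<eta> > 0" "\<And>y. f y \<le> f p + \<eta> \<Longrightarrow> r \<le> norm y"
      using norm_low_sublevel_ge[OF cv co least min] by blast
    have "\<forall>\<^sub>F t in at_top. f (x t) < f p + \<eta>"
      using order_tendstoD(2)[OF values_tendsto_min[OF \<open>\<alpha> > 3\<close>]] \<eta>(1) by simp
    then show ?thesis
    proof eventually_elim
      case (elim t)
      then have "r \<le> norm (x t)" using \<eta>(2) by simp
      then show ?case unfolding r_def by (rule sqrt_le_D)
    qed
  qed
  obtain T where T: "T \<ge> t0" and
    TT: "\<And>t. t \<ge> T \<Longrightarrow> \<delta> \<le> norm (x t - p) \<and> (norm p)\<^sup>2 - \<delta>\<^sup>2 / 2 \<le> (norm (x t))\<^sup>2"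
  proof -
    obtain N where N: "\<And>t. t \<ge> N \<Longrightarrow> \<delta> \<le> norm (x t - p) \<and> (norm p)\<^sup>2 - \<delta>\<^sup>2 / 2 \<le> (norm (x t))\<^sup>2"
      using eventually_conj[OF far low] unfolding eventually_at_top_linorder by blast
    show thesis by (rule that[of "max t0 N"]) (use N in auto)
  qed
  define \<kappa> where "\<kappa> = l * c / 2 * (\<delta>\<^sup>2 / 2)"
  have \<kappa>: "\<kappa> > 0" using l c \<open>\<delta> > 0\<close> by (simp add: \<kappa>_def)
  define F where "F s = energy l s + \<kappa> * ln s" for s
  have mono: "F t \<le> F T" if "t \<ge> T" for t
  proof (rule nonincreasing_if_derivative_nonpos[where a=t0 and F=F and 
      F'="\<lambda>s. energy_deriv l s + \<kappa> * (1 / s)"])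
    fix s assume s: "t0 \<le> s"
    then have s0: "s > 0" using t0 by linarith
    show "(F has_real_derivative energy_deriv l s + \<kappa> * (1 / s)) (at s within {t0..})"
      unfolding F_def using s0
      by (auto intro!: derivative_eq_intros energy_has_derivative[OF s])
  next
    fix s assume s: "T \<le> s"
    then have s0: "s > 0" "s \<ge> t0" using T t0 by linarith+
    have "\<delta>\<^sup>2 \<le> (norm (x s - p))\<^sup>2" using TT[OF s] \<open>\<delta> > 0\<close> by (intro power_mono) auto
    then have neg: "(norm p)\<^sup>2 - (norm (x s))\<^sup>2 - (norm (x s - p))\<^sup>2 \<le> - (\<delta>\<^sup>2 / 2)"
      using TT[OF s] by (simp add: field_simps)
    have "(2 - l) * (s * (f (x s) - f p)) \<le> 0"
      using l s0 min[of "x s"] by (intro mult_nonpos_nonneg) auto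
    moreover have "0 \<le> (\<alpha> - 1 - l) * (s * (norm (x' s))\<^sup>2)" using l s0 by simp
    moreover have "l * c / 2 * (((norm p)\<^sup>2 - (norm (x s))\<^sup>2 - (norm (x s - p))\<^sup>2) / s)
        \<le> l * c / 2 * (- (\<delta>\<^sup>2 / 2) / s)"
      using l c s0 neg by (intro mult_left_mono divide_right_mono) auto
    moreover have "l * c / 2 * (- (\<delta>\<^sup>2 / 2) / s) = - (\<kappa> * (1 / s))" by (simp add: \<kappa>_def)
    ultimately show "energy_deriv l s + \<kappa> * (1 / s) \<le> 0"
      using energy_deriv_le[OF s0(2), of l] l by linarith
  qed (use that T in auto)
  \<comment> \<open>A time at which \<open>\<kappa> ln t\<close> already exceeds the value \<open>F T\<close> that bounds \<open>F t\<close>.\<close>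
  define t where "t = max T (exp ((F T + 1) / \<kappa>))"
  have "t > 0" using T t0 by (simp add: t_def)
  then have "(F T + 1) / \<kappa> \<le> ln t" by (simp add: ln_ge_iff t_def)
  then have "F T + 1 \<le> \<kappa> * ln t" using \<kappa> by (simp add: field_simps)
  moreover have "energy l t + \<kappa> * ln t \<le> F T" using mono[of t] by (simp add: F_def t_def)
  moreover have "0 \<le> energy l t" using energy_dominates(4)[of l t] l by simp
  ultimately show False by linarith
qed

end

section \<open>Asymptotics of the trajectory\<close>

theorem theorem2:
  fixes f :: "'a::{real_inner, complete_space} \<Rightarrow> real"
    and gradf :: "'a \<Rightarrow> 'a"
    and x x' x'' :: "real \<Rightarrow> 'a"
    and t0 c \<alpha> :: real
  assumes convex: "convex_on UNIV f"
    and grad: "\<And>z. GDERIV f z :> gradf z"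
    and grad_cont: "continuous_on UNIV gradf"
    and grad_lip: "lipschitz_on_bounded_sets gradf"
    and argmin_ne: "argmin_set f \<noteq> {}"
    and "t0 > 0" and "c > 0" and "\<alpha> \<ge> 3"
    and sol: "is_solution gradf \<alpha> c t0 x x' x''"
  shows "(\<alpha> = 3 \<longrightarrow> (\<lambda>t. f (x t) - (INF y. f y)) \<in> O[at_top](\<lambda>t. ln t / t\<^sup>2))
       \<and> (\<alpha> > 3 \<longrightarrow>
            (\<lambda>t. f (x t) - (INF y. f y)) \<in> O[at_top](\<lambda>t. 1 / t\<^sup>2)
          \<and> bounded (x ` {t0..})
          \<and> (\<lambda>t. norm (x' t)) \<in> O[at_top](\<lambda>t. 1 / t)
          \<and> Liminf at_top (\<lambda>t. ereal (norm (x t - min_norm_element (argmin_set f)))) = 0)"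
proof -
  define p where "p = min_norm_element (argmin_set f)"
  have S: "q \<in> argmin_set f \<longleftrightarrow> (\<forall>y. f q \<le> f y)" for q
    by (auto simp: argmin_set_def is_arg_min_linorder)
  obtain q0 where q0: "\<And>y. f q0 \<le> f y" using argmin_ne S by auto
  have sub: "argmin_set f = {y. f y \<le> f q0}"
    using q0 S order_trans by blast
  have co: "continuous_on UNIV f"
    by (rule continuous_on_GDERIV[OF grad])
  have p: "p \<in> argmin_set f" and least: "\<And>y. y \<in> argmin_set f \<Longrightarrow> norm p \<le> norm y"
    using min_norm_element_works[OF argmin_ne] closed_sublevel[OF co] convex_on_sublevel[OF convex]
    unfolding sub p_def by auto
  have min: "\<And>y. f p \<le> f y" using p S by blast
  interpret tikhonov_trajectory f gradf \<alpha> c t0 x x' x'' p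
    by unfold_locales (fact convex grad min \<open>t0 > 0\<close> \<open>c > 0\<close> sol)+
  have inf: "(INF y. f y) = f p"
    using min by (intro cInf_eq_minimum) auto
  have fx: "\<bar>f (x t) - f p\<bar> = f (x t) - f p" for t using min[of "x t"] by simp
  have i: "(\<lambda>t. f (x t) - f p) \<in> O[at_top](\<lambda>t. ln t / t\<^sup>2)" if "\<alpha> = 3"
  proof -
    define A where "A = \<bar>energy 2 t0 - c * (norm p)\<^sup>2 * ln t0\<bar>"
    have "\<forall>\<^sub>F t in at_top. norm (f (x t) - f p) \<le> (A + c * (norm p)\<^sup>2) * norm (ln t / t\<^sup>2)"
      \<comment> \<open>From \<open>exp 1\<close> on, \<open>ln t \<ge> 1\<close> absorbs the constant of the logarithmic bound.\<close>
      using eventually_ge_at_top[of "max t0 (exp 1)"]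
    proof eventually_elim
      case (elim t)
      then have t: "t \<ge> t0" "t > 0" "exp 1 \<le> t" using t0 by auto
      then have ln1: "1 \<le> ln t" by (simp add: ln_ge_iff)
      then have abs_ln: "\<bar>ln t\<bar> = ln t" by simp
      have "t\<^sup>2 * (f (x t) - f p) \<le> A + c * (norm p)\<^sup>2 * ln t"
        using values_critical_bound[OF that t(1)] by (simp add: A_def algebra_simps)
      also have "\<dots> \<le> A * ln t + c * (norm p)\<^sup>2 * ln t"
        using mult_left_mono[OF ln1, of A] by (simp add: A_def)
      finally show ?case using t by (simp add: fx abs_ln field_simps)
    qed
    then show ?thesis by (rule bigoI)
  qed
  have ii: "(\<lambda>t. f (x t) - f p) \<in> O[at_top](\<lambda>t. 1 / t\<^sup>2) \<and> bounded (x ` {t0..})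
      \<and> (\<lambda>t. norm (x' t)) \<in> O[at_top](\<lambda>t. 1 / t)
      \<and> Liminf at_top (\<lambda>t. ereal (norm (x t - p))) = 0" if \<alpha>: "\<alpha> > 3"
  proof (intro conjI)
    obtain B R V where B: "\<And>t. t \<ge> t0 \<Longrightarrow> t\<^sup>2 * (f (x t) - f p) \<le> B"
      and R: "\<And>t. t \<ge> t0 \<Longrightarrow> norm (x t) \<le> R"
      and V: "\<And>t. t \<ge> t0 \<Longrightarrow> t * norm (x' t) \<le> V"
      using supercritical_bounds[OF \<alpha>] by metis
    have "\<forall>\<^sub>F t in at_top. norm (f (x t) - f p) \<le> B * norm (1 / t\<^sup>2)"
      using eventually_ge_at_top[of t0]
    proof eventually_elim
      case (elim t)
      then show ?case using B[of t] t0 by (simp add: fx field_simps)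
    qed
    then show "(\<lambda>t. f (x t) - f p) \<in> O[at_top](\<lambda>t. 1 / t\<^sup>2)" by (rule bigoI)
    show "bounded (x ` {t0..})" using R by (auto simp: bounded_iff)
    have "\<forall>\<^sub>F t in at_top. norm (norm (x' t)) \<le> V * norm (1 / t)"
      using eventually_ge_at_top[of t0]
    proof eventually_elim
      case (elim t)
      then show ?case using V[of t] t0 by (simp add: field_simps)
    qed
    then show "(\<lambda>t. norm (x' t)) \<in> O[at_top](\<lambda>t. 1 / t)" by (rule bigoI)
    show "Liminf at_top (\<lambda>t. ereal (norm (x t - p))) = 0"
    proof (rule antisym)
      show "0 \<le> Liminf at_top (\<lambda>t. ereal (norm (x t - p)))"
        by (rule Liminf_bounded) simp
      show "Liminf at_top (\<lambda>t. ereal (norm (x t - p))) \<le> 0"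
      proof (rule ccontr)
        assume "\<not> ?thesis"
        then have "0 < Liminf at_top (\<lambda>t. ereal (norm (x t - p)))" by simp
        then obtain d where d: "0 < d" "d < Liminf at_top (\<lambda>t. ereal (norm (x t - p)))"
          using dense by blast
        then obtain \<delta> where \<delta>: "d = ereal \<delta>" "\<delta> > 0" 
          by (cases d) auto
        have "\<forall>\<^sub>F t in at_top. ereal \<delta> < ereal (norm (x t - p))"
          using less_LiminfD d(2) \<delta>(1) by blast
        then have "\<forall>\<^sub>F t in at_top. \<not> norm (x t - p) < \<delta>"
          by eventually_elim simp
        then show False
          using frequently_near_min_norm[OF \<alpha> \<delta>(2)] least S by (simp add: frequently_def)
      qed
    qed
  qed
  show ?thesis using i ii unfolding inf p_def[symmetric] by blast
qed

end
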